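(* Let $(S,\leq)$ be a (not necessarily commutative) ordered semiring and $(x_i)_{i=1}^{n}$ be a sequence of $n$ elements in $S$ such that $x_i\geq 0$ and $1+x_i\geq 0$ for each $1\leq i\leq n$. Then $$\prod_{i=1}^{n}(1+x_i)\geq 1+\sum_{i=1}^{n}x_i.$$
   Context: An ordered semiring $(S,+,\cdot,0,1,\leq)$ is a semiring with multiplicative identity $1$ and a partial order $\leq$ such that: $(S,+,0,\leq)$ is a commutative ordered monoid (the order $\leq$ is compatible with $+$); $(S,\cdot,1)$ is a monoid, and $a\leq b$, $0\leq c$ imply $ac\leq bc$ and $ca\leq cb$ for all $a,b,c\in S$; multiplication distributes over addition on both sides, and $0s=s0=0$ for all $s\in S$. The product $\prod_{i=1}^n(1+x_i)$ is the product of the factors taken in the order of their indices. *)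

theory Defs
  imports Main
begin

text \<open>
  The library class \<^class>\<open>ordered_semiring_1\<close> additionally assumes \<open>0 < 1\<close> (hence \<open>0 \<noteq> 1\<close>).
  Here neither that nor \<open>0 \<le> 1\<close> is required, and the order need not be total.
\<close>

class ordered_unital_semiring = ordered_semiring_0 + monoid_mult

end

theory Submission
  imports Defs
begin

text \<open>
  This is Bernoulli's inequality by induction on the number of factors. Since \<open>0 \<le> 1 + a\<close>, the
  inequality \<open>1 + s \<le> p\<close> may be multiplied by \<open>1 + a\<close> from the left, which gives
  \<open>(1 + a) * p \<ge> 1 + (a + s) + a * s\<close>; the last term is nonnegative because \<open>a\<close> and \<open>s\<close> are.
  Each new factor is attached on the left throughout, so the argument respects noncommutativity.
  In a partial order \<open>0 \<le> 1\<close> can fail, so \<open>0 \<le> 1 + a\<close> does not follow from \<open>0 \<le> a\<close>.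
\<close>

lemma one_plus_sum_list_le_prod_list:
  fixes xs :: "'a::ordered_unital_semiring list"
  assumes "\<And>a. a \<in> set xs \<Longrightarrow> 0 \<le> a"
    and "\<And>a. a \<in> set xs \<Longrightarrow> 0 \<le> 1 + a"
  shows "1 + sum_list xs \<le> prod_list (map (\<lambda>a. 1 + a) xs)"
  using assms
proof (induction xs)
  case Nil
  then show ?case by simp
next
  case (Cons a xs)
  have IH: "1 + sum_list xs \<le> prod_list (map (\<lambda>a. 1 + a) xs)"
    using Cons by simp
  have "0 \<le> a * sum_list xs"
    using Cons.prems(1) by (intro mult_nonneg_nonneg sum_list_nonneg) simp_all
  then have "1 + (a + sum_list xs) + 0 \<le> 1 + (a + sum_list xs) + a * sum_list xs"
    by (rule add_left_mono)
  also have "\<dots> = (1 + a) * (1 + sum_list xs)"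
    by (simp add: distrib_left distrib_right ac_simps)
  also have "\<dots> \<le> (1 + a) * prod_list (map (\<lambda>a. 1 + a) xs)"
    using IH Cons.prems(2) by (intro mult_left_mono) simp_all
  finally show ?case by simp
qed

theorem theorem4p2:
  fixes x :: "nat \<Rightarrow> 'a::ordered_unital_semiring" and n :: nat
  assumes "\<And>i. 1 \<le> i \<Longrightarrow> i \<le> n \<Longrightarrow> x i \<ge> 0"
    and "\<And>i. 1 \<le> i \<Longrightarrow> i \<le> n \<Longrightarrow> 1 + x i \<ge> 0"
  shows "prod_list (map (\<lambda>i. 1 + x i) [1..<Suc n]) \<ge> 1 + (\<Sum>i=1..n. x i)"
proof -
  have "(\<Sum>i=1..n. x i) = sum_list (map x [1..<Suc n])"
    by (simp only: interv_sum_list_conv_sum_set_nat set_upt atLeastLessThanSuc_atLeastAtMost)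
  moreover have "1 + sum_list (map x [1..<Suc n])
      \<le> prod_list (map (\<lambda>a. 1 + a) (map x [1..<Suc n]))"
    using assms by (intro one_plus_sum_list_le_prod_list) auto
  ultimately show ?thesis
    by (simp only: map_map comp_def)
qed

end
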